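(* Let $H$ be a real Hilbert space, let $A,B\colon H\rightrightarrows H$ be maximal monotone operators, let $z\in H$ and $\beta\in(0,1)$. Let $\{r_k\}_{k\ge 0}$ be a sequence of positive reals with $r_0\in(0,2(1-\beta)/\beta)$ and $r_{k+1}=r_k/\sqrt{1+2r_k(1-\beta)/\beta}$ for all $k\ge 0$. Let $z_0\in H$ be arbitrary, and set $$x_0=\beta J_{\frac{2r_0(1-\beta)}{\beta+r_0(1-\beta)}A}\left(\frac{1}{\beta+r_0(1-\beta)}z_0+z\right)-\beta z,\qquad y_0=\frac{1}{r_0}(z_0-x_0),$$ and for $k=1,2,\dots$ $$x_k=\beta J_{\frac{2r_{k-1}(1-\beta)}{\beta+r_{k-1}(1-\beta)}A}\left(\frac{1}{\beta+r_{k-1}(1-\beta)}(z_{k-1}+r_{k-1}y_{k-1})+z\right)-\beta z,$$ $$y_k=\frac{1}{r_{k-1}}(z_{k-1}+r_{k-1}y_{k-1}-x_k),$$ $$z_k=\beta J_{\frac{2r_k(1-\beta)}{\beta+r_k(1-\beta)}B}\left(\frac{1}{\beta+r_k(1-\beta)}(x_k-r_ky_k)+z\right)-\beta z.$$ If $S:=\{u\in H: z\in (I+A+B)(u)\}\neq\emptyset$, then $\{\frac1\beta x_k+z\}$ converges strongly (in norm) to $J_{A+B}(z)$. In particular, $$\left\Vert \frac1\beta x_{k+1}+z-J_{A+B}(z)\right\Vert=O(1/k)\quad (k\to\infty).$$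
   Context: $I$ is the identity on $H$. For a maximal monotone operator $M$ on $H$ and $\rho>0$, the resolvent $J_{\rho M}=(I+\rho M)^{-1}$ is a single-valued map $H\to H$. When $S\ne\emptyset$, monotonicity of $A+B$ implies that $S$ is a singleton, and $J_{A+B}(z)=(I+A+B)^{-1}(z)$ denotes its unique element. *)

theory Defs
  imports "HOL-Analysis.Analysis" "HOL-Library.Landau_Symbols"
begin

text \<open>A set-valued operator \<open>H \<rightrightarrows> H\<close> is a function \<open>M :: 'a \<Rightarrow> 'a set\<close>; its graph is
  the set of pairs \<open>(u, a)\<close> with \<open>a \<in> M u\<close>.\<close>

definition monotone_operator :: "('a::real_inner \<Rightarrow> 'a set) \<Rightarrow> bool" where
  "monotone_operator M \<longleftrightarrow>
     (\<forall>u v. \<forall>a\<in>M u. \<forall>b\<in>M v. 0 \<le> inner (u - v) (a - b))"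

text \<open>The order \<open>M \<le> N\<close> on functions into sets is pointwise inclusion, that is, inclusion of
  graphs.\<close>

definition maximal_monotone :: "('a::real_inner \<Rightarrow> 'a set) \<Rightarrow> bool" where
  "maximal_monotone M \<longleftrightarrow>
     monotone_operator M \<and> (\<forall>N. monotone_operator N \<and> M \<le> N \<longrightarrow> N = M)"

definition op_id :: "'a \<Rightarrow> 'a set" where
  "op_id u = {u}"

definition op_add :: "('a::real_vector \<Rightarrow> 'a set) \<Rightarrow> ('a \<Rightarrow> 'a set) \<Rightarrow> 'a \<Rightarrow> 'a set" where
  "op_add M N u = {a + b | a b. a \<in> M u \<and> b \<in> N u}"

definition op_scale :: "real \<Rightarrow> ('a::real_vector \<Rightarrow> 'a set) \<Rightarrow> 'a \<Rightarrow> 'a set" where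
  "op_scale \<rho> M u = {\<rho> *\<^sub>R a | a. a \<in> M u}"

definition op_inverse :: "('a \<Rightarrow> 'a set) \<Rightarrow> 'a \<Rightarrow> 'a set" where
  "op_inverse M x = {u. x \<in> M u}"

text \<open>\<open>J\<^sub>M = (I + M)\<^sup>-\<^sup>1\<close> as a point-valued map. The value at \<open>x\<close> is meaningful only when the set
  \<open>(I + M)\<^sup>-\<^sup>1(x)\<close> is a singleton: for every \<open>x\<close> if \<open>M\<close> is a positive multiple of a maximal
  monotone operator, and whenever the set is nonempty if \<open>M\<close> is merely monotone.\<close>

definition resolvent :: "('a::real_vector \<Rightarrow> 'a set) \<Rightarrow> 'a \<Rightarrow> 'a" where
  "resolvent M x = the_elem (op_inverse (op_add op_id M) x)"

end

theory Submission
  imports Defs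
begin

text \<open>Why the theorem holds.  In the variable \<open>x = \<beta> (w - z)\<close> the inclusion \<open>z \<in> w + A w + B w\<close>
  becomes \<open>0 \<in> T\<^sub>A x + T\<^sub>B x\<close>, where \<open>T\<^sub>A\<close> and \<open>T\<^sub>B\<close> are obtained from \<open>A\<close> and \<open>B\<close> by an affine
  change of variable and by adding \<open>\<gamma> x\<close> with \<open>\<gamma> = (1 - \<beta>) / \<beta>\<close>; both are therefore strongly
  monotone with modulus \<open>\<gamma>\<close>.  The iteration is a splitting method for this sum with varying
  step size \<open>r\<close>: each step evaluates one resolvent of \<open>T\<^sub>A\<close> or of \<open>T\<^sub>B\<close>, so it produces \<open>y\<^sub>k \<in> T\<^sub>A x\<^sub>k\<close> and \<open>b\<^sub>k \<in> T\<^sub>B z\<^sub>k\<close>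
  for \<open>k \<ge> 1\<close> (\<open>resolvent_step_mem\<close>).

  Let \<open>x\<close> be the solution and \<open>y \<in> T\<^sub>A x\<close> with \<open>- y \<in> T\<^sub>B x\<close>.  Expanding squares and using
  strong monotonicity of \<open>T\<^sub>A\<close> and monotonicity of \<open>T\<^sub>B\<close> gives (\<open>splitting_step_decrease\<close>)
  \<open>(1 + 2 r\<^sub>k \<gamma>) \<parallel>x\<^sub>k\<^sub>+\<^sub>1 - x\<parallel>\<^sup>2 + r\<^sub>k\<^sup>2 \<parallel>y\<^sub>k\<^sub>+\<^sub>1 - y\<parallel>\<^sup>2 \<le> \<parallel>x\<^sub>k - x\<parallel>\<^sup>2 + r\<^sub>k\<^sup>2 \<parallel>y\<^sub>k - y\<parallel>\<^sup>2\<close>.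
  The step sizes are chosen so that \<open>(1 + 2 r\<^sub>k \<gamma>) / r\<^sub>k\<^sup>2 = 1 / r\<^sub>k\<^sub>+\<^sub>1\<^sup>2\<close>; after division by \<open>r\<^sub>k\<^sup>2\<close>
  the quantity \<open>\<parallel>x\<^sub>k - x\<parallel>\<^sup>2 / r\<^sub>k\<^sup>2 + \<parallel>y\<^sub>k - y\<parallel>\<^sup>2\<close> is thus nonincreasing for \<open>k \<ge> 1\<close>.  Hence
  \<open>\<parallel>x\<^sub>k - x\<parallel> = O(r\<^sub>k)\<close>, and \<open>r\<^sub>k = O(1/k)\<close> because \<open>1 / r\<^sub>k\<close> grows at least linearly
  (\<open>step_size_bound\<close>).

  That the resolvents in the iteration solve the inclusions they stand for is Minty's theorem
  (\<open>minty\<close>), proved here by minimising the Fitzpatrick function plus half the squared norm.\<close>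

section \<open>Maximal monotone operators and their resolvents\<close>

lemma maximal_monotone_iff:
  "maximal_monotone M \<longleftrightarrow> monotone_operator M \<and>
     (\<forall>u a. (\<forall>v. \<forall>b\<in>M v. 0 \<le> inner (u - v) (a - b)) \<longrightarrow> a \<in> M u)"
proof (intro iffI conjI allI impI)
  assume M: "maximal_monotone M"
  then show "monotone_operator M"
    by (simp add: maximal_monotone_def)
  fix u a
  assume rel: "\<forall>v. \<forall>b\<in>M v. 0 \<le> inner (u - v) (a - b)"
  \<comment> \<open>Adjoining the related pair to the graph keeps it monotone, so maximality absorbs it.\<close>
  define N where "N = M(u := insert a (M u))"
  have rel': "0 \<le> inner (v - u) (b - a)" if "b \<in> M v" for v b
    using rel that inner_minus_left[of "u - v" "a - b"] inner_minus_right[of "v - u" "a - b"]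
    by simp
  have "monotone_operator N"
    using M rel rel' unfolding maximal_monotone_def monotone_operator_def N_def by auto
  moreover have "M \<le> N"
    by (auto simp: N_def le_fun_def)
  ultimately have "N = M"
    using M by (auto simp: maximal_monotone_def)
  then show "a \<in> M u"
    unfolding N_def by (metis fun_upd_same insertI1)
next
  assume M: "monotone_operator M \<and>
     (\<forall>u a. (\<forall>v. \<forall>b\<in>M v. 0 \<le> inner (u - v) (a - b)) \<longrightarrow> a \<in> M u)"
  show "maximal_monotone M"
    unfolding maximal_monotone_def
  proof (intro conjI allI impI)
    fix N
    assume N: "monotone_operator N \<and> M \<le> N"
    have "N u \<subseteq> M u" for u
    proof
      fix a assume "a \<in> N u"
      then have "\<forall>v. \<forall>b\<in>M v. 0 \<le> inner (u - v) (a - b)"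
        using N unfolding monotone_operator_def le_fun_def by blast
      then show "a \<in> M u"
        using M by blast
    qed
    then show "N = M"
      using N by (intro antisym) (auto simp: le_fun_def)
  qed (use M in simp)
qed

text \<open>The substitute for weak compactness: the objective is strongly convex in \<open>u\<close>, so by the
  parallelogram identity every minimising sequence is Cauchy in \<open>u\<close>, and then \<open>t\<close> converges
  because the objective values do.  The conclusion is the first-order optimality condition at the
  minimiser, which is all that is needed of it.\<close>

lemma epigraph_variational_point:
  fixes E :: "('b::{real_inner, complete_space} \<times> real) set"
  assumes "convex E" "closed E" "E \<noteq> {}"
    and below: "\<And>u t. (u, t) \<in> E \<Longrightarrow> m \<le> t + (norm u)\<^sup>2 / 2"
  obtains p s where "(p, s) \<in> E"
    and "\<And>w t. (w, t) \<in> E \<Longrightarrow> s + (norm p)\<^sup>2 \<le> t + inner w p"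
proof -
  define \<phi> where "\<phi> e = snd e + (norm (fst e))\<^sup>2 / 2" for e :: "'b \<times> real"
  define \<mu> where "\<mu> = Inf (\<phi> ` E)"
  have bdd: "bdd_below (\<phi> ` E)"
    using below by (intro bdd_belowI[of _ m]) (auto simp: \<phi>_def)
  have \<mu>: "\<mu> \<le> \<phi> e" if "e \<in> E" for e
    unfolding \<mu>_def using bdd that by (intro cInf_lower) auto
  have "\<exists>e\<in>E. \<phi> e < \<mu> + inverse (Suc n)" for n
  proof -
    have "\<exists>y\<in>\<phi> ` E. y < \<mu> + inverse (Suc n)"
      using bdd \<open>E \<noteq> {}\<close> by (subst cInf_less_iff[symmetric]) (auto simp: \<mu>_def)
    then show ?thesis by blast
  qed
  then obtain e where e: "\<And>n. e n \<in> E" "\<And>n. \<phi> (e n) < \<mu> + inverse (Suc n)"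
    by metis
  have mid: "(norm (fst (e i) - fst (e j)))\<^sup>2 \<le> 4 * (inverse (Suc i) + inverse (Suc j))" for i j
  proof -
    have "(1/2) *\<^sub>R e i + (1/2) *\<^sub>R e j \<in> E"
      using \<open>convex E\<close> e by (intro convexD) auto
    then have "\<mu> \<le> \<phi> ((1/2) *\<^sub>R e i + (1/2) *\<^sub>R e j)"
      by (rule \<mu>)
    also have "\<dots> = (\<phi> (e i) + \<phi> (e j)) / 2 - (norm (fst (e i) - fst (e j)))\<^sup>2 / 8"
      by (simp add: \<phi>_def power2_norm_eq_inner inner_add_left inner_add_right
          inner_diff_left inner_diff_right inner_commute field_simps)
    finally have "(norm (fst (e i) - fst (e j)))\<^sup>2 \<le> 4 * (\<phi> (e i) - \<mu> + (\<phi> (e j) - \<mu>))"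
      by argo
    also have "\<dots> \<le> 4 * (inverse (Suc i) + inverse (Suc j))"
      using e(2)[of i] e(2)[of j] by (intro mult_left_mono add_mono) auto
    finally show ?thesis .
  qed
  have "Cauchy (\<lambda>n. fst (e n))"
  proof (rule metric_CauchyI)
    fix \<epsilon> :: real assume "0 < \<epsilon>"
    then obtain n0 where n0: "inverse (real (Suc n0)) < \<epsilon>\<^sup>2 / 8"
      using reals_Archimedean[of "\<epsilon>\<^sup>2 / 8"] by auto
    have "dist (fst (e i)) (fst (e j)) < \<epsilon>" if "n0 \<le> i" "n0 \<le> j" for i j
    proof -
      have "inverse (real (Suc i)) \<le> inverse (real (Suc n0))"
           "inverse (real (Suc j)) \<le> inverse (real (Suc n0))"
        using that by (auto intro!: le_imp_inverse_le)
      then have "(norm (fst (e i) - fst (e j)))\<^sup>2 < \<epsilon>\<^sup>2"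
        using mid[of i j] n0 by argo
      then show ?thesis
        using \<open>0 < \<epsilon>\<close> by (simp add: dist_norm power2_less_imp_less)
    qed
    then show "\<exists>M. \<forall>i\<ge>M. \<forall>j\<ge>M. dist (fst (e i)) (fst (e j)) < \<epsilon>"
      by blast
  qed
  then obtain p where p: "(\<lambda>n. fst (e n)) \<longlonglongrightarrow> p"
    using Cauchy_convergent convergent_def by blast
  have "(\<lambda>n. \<phi> (e n)) \<longlonglongrightarrow> \<mu>"
  proof (rule tendsto_sandwich[OF _ _ tendsto_const])
    show "(\<lambda>n. \<mu> + inverse (real (Suc n))) \<longlonglongrightarrow> \<mu>"
      using tendsto_add[OF tendsto_const LIMSEQ_inverse_real_of_nat, of \<mu>] by simp
  qed (use e \<mu> in \<open>auto intro!: always_eventually less_imp_le\<close>)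
  define s where "s = \<mu> - (norm p)\<^sup>2 / 2"
  have "(\<lambda>n. \<phi> (e n) - (norm (fst (e n)))\<^sup>2 / 2) \<longlonglongrightarrow> s"
    unfolding s_def by (intro tendsto_intros p \<open>(\<lambda>n. \<phi> (e n)) \<longlonglongrightarrow> \<mu>\<close>) auto
  then have "(\<lambda>n. snd (e n)) \<longlonglongrightarrow> s"
    by (simp add: \<phi>_def)
  with p have "(\<lambda>n. (fst (e n), snd (e n))) \<longlonglongrightarrow> (p, s)"
    by (rule tendsto_Pair)
  then have ps: "(p, s) \<in> E"
    using \<open>closed E\<close> e(1) closed_sequentially[of E e] by simp
  moreover have "s + (norm p)\<^sup>2 \<le> t + inner w p" if wt: "(w, t) \<in> E" for w t
  proof -
    define D where "D = t - s + inner p (w - p)"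
    define K where "K = (norm (w - p))\<^sup>2 / 2"
    \<comment> \<open>Minimality along the segment from \<open>(p, s)\<close> to \<open>(w, t)\<close>, divided by the parameter \<open>c\<close>.\<close>
    have "0 \<le> D + c * K" if "0 < c" "c \<le> 1" for c
    proof -
      have "(1 - c) *\<^sub>R (p, s) + c *\<^sub>R (w, t) \<in> E"
        using \<open>convex E\<close> ps wt that by (intro convexD) auto
      from \<mu>[OF this] have "s + (norm p)\<^sup>2 / 2 \<le>
          (1 - c) * s + c * t + (norm (p + c *\<^sub>R (w - p)))\<^sup>2 / 2"
        by (simp add: \<phi>_def s_def algebra_simps)
      also have "\<dots> = s + (norm p)\<^sup>2 / 2 + c * (D + c * K)"
        by (simp add: D_def K_def power2_norm_eq_inner inner_add_left inner_add_right
            inner_diff_left inner_diff_right inner_commute field_simps)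
      finally show ?thesis
        using \<open>0 < c\<close> by (simp add: zero_le_mult_iff)
    qed
    then have "0 \<le> D + inverse (real (Suc n)) * K" for n
      by (simp add: inverse_le_1_iff)
    moreover have "(\<lambda>n. D + inverse (real (Suc n)) * K) \<longlonglongrightarrow> D + 0 * K"
      by (intro tendsto_intros LIMSEQ_inverse_real_of_nat)
    ultimately have "0 \<le> D"
      by (intro LIMSEQ_le_const[of "\<lambda>n. D + inverse (real (Suc n)) * K" D 0]) auto
    then show ?thesis
      by (simp add: D_def inner_diff_right power2_norm_eq_inner inner_commute)
  qed
  ultimately show ?thesis
    by (rule that)
qed

text \<open>Minty's theorem at the origin, following Fitzpatrick.  The set \<open>E\<close> is the epigraph of
  \<open>F(x, y) = sup {\<langle>x, b\<rangle> + \<langle>y, v\<rangle> - \<langle>v, b\<rangle> | b \<in> M v}\<close>, which is convex and lower semicontinuous,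
  satisfies \<open>F(v, b) \<le> \<langle>v, b\<rangle>\<close> on the graph by monotonicity and \<open>F(x, y) \<ge> \<langle>x, y\<rangle>\<close> everywhere
  by maximality.  At the minimiser \<open>(x, y)\<close> of \<open>F\<close> plus half the squared norm, optimality tested
  on graph points says \<open>\<parallel>x + y\<parallel>\<^sup>2 \<le> \<langle>v + y, b + x\<rangle>\<close>.  By maximality \<open>(- y, - x)\<close> is then itself in
  the graph, and testing with this point forces \<open>y = - x\<close>.\<close>

lemma minty_zero:
  fixes M :: "'a::{real_inner, complete_space} \<Rightarrow> 'a set"
  assumes M: "maximal_monotone M"
  shows "\<exists>u. - u \<in> M u"
proof -
  have mono: "\<And>u v a b. a \<in> M u \<Longrightarrow> b \<in> M v \<Longrightarrow> 0 \<le> inner (u - v) (a - b)"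
    and maxi: "\<And>u a. (\<And>v b. b \<in> M v \<Longrightarrow> 0 \<le> inner (u - v) (a - b)) \<Longrightarrow> a \<in> M u"
    using M unfolding maximal_monotone_iff monotone_operator_def by blast+
  define E :: "(('a \<times> 'a) \<times> real) set" where
    "E = (\<Inter>v. \<Inter>b\<in>M v. {e. inner (fst e) (b, v) - inner v b \<le> snd e})"
  have E_iff: "((x, y), t) \<in> E \<longleftrightarrow>
      (\<forall>v. \<forall>b\<in>M v. inner x b + inner y v - inner v b \<le> t)" for x y t
    by (simp add: E_def)
  have above: "inner x y \<le> t" if "((x, y), t) \<in> E" for x y t
  proof (rule ccontr)
    assume "\<not> inner x y \<le> t"
    then have lt: "inner x b + inner y v - inner v b < inner x y" if "b \<in> M v" for v b
      using \<open>((x, y), t) \<in> E\<close> that unfolding E_iff by fastforce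
    then have "y \<in> M x"
      by (intro maxi) (force simp: inner_diff_left inner_diff_right inner_commute less_imp_le)
    from lt[OF this] show False
      by (simp add: inner_commute)
  qed
  have graph: "((v, b), inner v b) \<in> E" if "b \<in> M v" for v b
    unfolding E_iff
    using mono[OF that] by (fastforce simp: inner_diff_left inner_diff_right inner_commute)
  have "convex E"
    unfolding E_def
  proof (intro convex_INT)
    fix v b
    show "convex {e :: ('a \<times> 'a) \<times> real. inner (fst e) (b, v) - inner v b \<le> snd e}"
    proof (rule convexI, simp only: mem_Collect_eq)
      fix e f :: "('a \<times> 'a) \<times> real" and c d :: real
      assume *: "inner (fst e) (b, v) - inner v b \<le> snd e"
        "inner (fst f) (b, v) - inner v b \<le> snd f" and cd: "0 \<le> c" "0 \<le> d" "c + d = 1"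
      have "inner (fst (c *\<^sub>R e + d *\<^sub>R f)) (b, v) - inner v b
          = c * (inner (fst e) (b, v) - inner v b) + d * (inner (fst f) (b, v) - inner v b)
            + (c + d - 1) * inner v b"
        by (simp only: fst_add fst_scaleR inner_add_left inner_scaleR_left) (simp add: algebra_simps)
      also have "\<dots> \<le> snd (c *\<^sub>R e + d *\<^sub>R f)"
        using * cd by (auto intro!: add_mono mult_left_mono)
      finally show "inner (fst (c *\<^sub>R e + d *\<^sub>R f)) (b, v) - inner v b \<le> snd (c *\<^sub>R e + d *\<^sub>R f)" .
    qed
  qed
  moreover have "closed E"
    unfolding E_def by (intro closed_INT ballI closed_Collect_le continuous_intros)
  moreover have "E \<noteq> {}"
  proof -
    have "\<exists>v b. b \<in> M v"
      \<comment> \<open>Every pair is vacuously related to an empty graph.\<close>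
      using maxi[of 0 0] by blast
    then show ?thesis
      using graph by blast
  qed
  moreover have "0 \<le> t + (norm e)\<^sup>2 / 2" if "(e, t) \<in> E" for e t
  proof -
    obtain x y where e: "e = (x, y)" by fastforce
    have "0 \<le> (norm (x + y))\<^sup>2 / 2"
      by simp
    also have "\<dots> = inner x y + (norm e)\<^sup>2 / 2"
      by (simp add: e power2_norm_eq_inner inner_add_left inner_add_right inner_commute field_simps)
    also have "\<dots> \<le> t + (norm e)\<^sup>2 / 2"
      using above that e by simp
    finally show ?thesis .
  qed
  ultimately obtain q s where q: "(q, s) \<in> E"
    and opt: "\<And>w t. (w, t) \<in> E \<Longrightarrow> s + (norm q)\<^sup>2 \<le> t + inner w q"
    using epigraph_variational_point[of E 0] by metis
  obtain x y where xy: "q = (x, y)" by fastforce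
  have key: "(norm (x + y))\<^sup>2 \<le> inner (v + y) (b + x)" if "b \<in> M v" for v b
  proof -
    have "inner x y \<le> s"
      using above q xy by simp
    then show ?thesis
      using opt[OF graph[OF that]]
      by (simp add: xy power2_norm_eq_inner inner_add_left inner_add_right inner_commute)
  qed
  have "- x \<in> M (- y)"
  proof (rule maxi)
    fix v b assume "b \<in> M v"
    have "0 \<le> inner (v + y) (b + x)"
      by (rule order_trans[OF _ key[OF \<open>b \<in> M v\<close>]]) simp
    also have "\<dots> = inner (- y - v) (- x - b)"
      by (simp add: inner_add_left inner_add_right inner_diff_left inner_diff_right)
    finally show "0 \<le> inner (- y - v) (- x - b)" .
  qed
  then have "- y = x"
    using key[of "- x" "- y"] by (simp add: eq_neg_iff_add_eq_0 add.commute neg_eq_iff_add_eq_0)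
  then show ?thesis
    using \<open>- x \<in> M (- y)\<close> by auto
qed

text \<open>Scaling the values of \<open>M\<close> and translating them by \<open>p\<close> preserves maximal monotonicity, so the
  general inclusion \<open>p \<in> u + \<rho> M u\<close> reduces to the one at the origin.\<close>

lemma minty:
  fixes M :: "'a::{real_inner, complete_space} \<Rightarrow> 'a set"
  assumes M: "maximal_monotone M" and \<rho>: "0 < \<rho>"
  shows "\<exists>u. p \<in> op_add op_id (op_scale \<rho> M) u"
proof -
  define N where "N u = {c. (1 / \<rho>) *\<^sub>R (c + p) \<in> M u}" for u
  have eq: "inner d ((1 / \<rho>) *\<^sub>R (a + p) - (1 / \<rho>) *\<^sub>R (b + p)) = inner d (a - b) / \<rho>" for d a b :: 'a
    by (simp add: inner_diff_right inner_add_right diff_divide_distrib add_divide_distrib)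
  have "maximal_monotone N"
    unfolding maximal_monotone_iff
  proof (intro conjI allI impI)
    show "monotone_operator N"
      unfolding monotone_operator_def
    proof (intro allI ballI)
      fix u v a b assume "a \<in> N u" "b \<in> N v"
      then have "0 \<le> inner (u - v) ((1 / \<rho>) *\<^sub>R (a + p) - (1 / \<rho>) *\<^sub>R (b + p))"
        using M unfolding maximal_monotone_iff monotone_operator_def N_def by blast
      then show "0 \<le> inner (u - v) (a - b)"
        using \<rho> unfolding eq by (simp add: zero_le_divide_iff)
    qed
    fix u a assume rel: "\<forall>v. \<forall>b\<in>N v. 0 \<le> inner (u - v) (a - b)"
    have "0 \<le> inner (u - v) ((1 / \<rho>) *\<^sub>R (a + p) - b)" if "b \<in> M v" for v b
    proof -
      have "\<rho> *\<^sub>R b - p \<in> N v"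
        using that \<rho> by (simp add: N_def)
      then have "0 \<le> inner (u - v) (a - (\<rho> *\<^sub>R b - p)) / \<rho>"
        using rel \<rho> by simp
      then show ?thesis
        using \<rho> unfolding eq[symmetric] by simp
    qed
    then show "a \<in> N u"
      using M unfolding maximal_monotone_iff N_def by blast
  qed
  then obtain u where "- u \<in> N u"
    using minty_zero by blast
  then have "(1 / \<rho>) *\<^sub>R (p - u) \<in> M u"
    by (simp add: N_def)
  moreover have "p = u + \<rho> *\<^sub>R ((1 / \<rho>) *\<^sub>R (p - u))"
    using \<rho> by simp
  ultimately show ?thesis
    unfolding op_add_def op_id_def op_scale_def by blast
qed

lemma resolvent_eqI:
  assumes "monotone_operator M" and u: "x \<in> op_add op_id M u"
  shows "resolvent M x = u"
proof -
  have "v = u" if v: "x \<in> op_add op_id M v" for v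
  proof -
    have "x - u \<in> M u"
      using u unfolding op_add_def op_id_def by force
    moreover have "x - v \<in> M v"
      using v unfolding op_add_def op_id_def by force
    ultimately have "0 \<le> inner (u - v) ((x - u) - (x - v))"
      using assms(1) unfolding monotone_operator_def by blast
    also have "\<dots> = - (norm (u - v))\<^sup>2"
      by (simp add: power2_norm_eq_inner inner_diff_left inner_diff_right inner_commute)
    finally show ?thesis by simp
  qed
  then have "op_inverse (op_add op_id M) x = {u}"
    using u unfolding op_inverse_def by blast
  then show ?thesis
    by (simp add: resolvent_def)
qed

lemma monotone_operator_scale:
  assumes "monotone_operator M" "0 \<le> \<rho>"
  shows "monotone_operator (op_scale \<rho> M)"
  using assms unfolding monotone_operator_def op_scale_def
  by (auto simp: scaleR_diff_right[symmetric])

lemma monotone_operator_add: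
  assumes "monotone_operator M" "monotone_operator N"
  shows "monotone_operator (op_add M N)"
proof -
  have "0 \<le> inner (u - v) ((a + b) - (a' + b'))"
    if "a \<in> M u" "b \<in> N u" "a' \<in> M v" "b' \<in> N v" for u v a b a' b'
  proof -
    have "0 \<le> inner (u - v) (a - a') + inner (u - v) (b - b')"
      using assms that unfolding monotone_operator_def by (intro add_nonneg_nonneg) blast+
    then show ?thesis
      by (simp add: inner_add_right inner_diff_right)
  qed
  then show ?thesis
    unfolding monotone_operator_def op_add_def by blast
qed

lemma resolvent_scale_mem:
  fixes M :: "'a::{real_inner, complete_space} \<Rightarrow> 'a set"
  assumes M: "maximal_monotone M" and \<rho>: "0 < \<rho>"
  shows "(1 / \<rho>) *\<^sub>R (p - resolvent (op_scale \<rho> M) p) \<in> M (resolvent (op_scale \<rho> M) p)"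
proof -
  obtain u where u: "p \<in> op_add op_id (op_scale \<rho> M) u"
    using minty[OF assms] by blast
  have "monotone_operator (op_scale \<rho> M)"
    using M \<rho> by (intro monotone_operator_scale) (auto simp: maximal_monotone_def)
  with u have "resolvent (op_scale \<rho> M) p = u"
    by (intro resolvent_eqI)
  moreover obtain a where "a \<in> M u" "p = u + \<rho> *\<^sub>R a"
    using u unfolding op_add_def op_id_def op_scale_def by blast
  ultimately show ?thesis
    using \<rho> by simp
qed

section \<open>The strongly monotone splitting behind the iteration\<close>

text \<open>This is \<open>T\<^sub>M\<close>.  With \<open>w = x / \<beta> + z\<close>, the sum \<open>T\<^sub>A x + T\<^sub>B x\<close> equals
  \<open>2 (1 - \<beta>) (A w + B w + w - z)\<close>, so its zeros correspond to the solutions of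
  \<open>z \<in> w + A w + B w\<close>; the term \<open>w - z\<close> is shared equally between the two operators.\<close>

definition strengthened :: "real \<Rightarrow> 'a::real_vector \<Rightarrow> ('a \<Rightarrow> 'a set) \<Rightarrow> 'a \<Rightarrow> 'a set" where
  "strengthened \<beta> z M x =
     {(2 * (1 - \<beta>)) *\<^sub>R a + ((1 - \<beta>) / \<beta>) *\<^sub>R x | a. a \<in> M ((1 / \<beta>) *\<^sub>R x + z)}"

lemma strengthened_strongly_monotone:
  assumes M: "monotone_operator M" and \<beta>: "0 < \<beta>" "\<beta> < 1"
    and "a \<in> strengthened \<beta> z M x" "b \<in> strengthened \<beta> z M y"
  shows "(1 - \<beta>) / \<beta> * (norm (x - y))\<^sup>2 \<le> inner (x - y) (a - b)"
proof -
  obtain a' b' where a': "a' \<in> M ((1 / \<beta>) *\<^sub>R x + z)" "a = (2 * (1 - \<beta>)) *\<^sub>R a' + ((1 - \<beta>) / \<beta>) *\<^sub>R x"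
    and b': "b' \<in> M ((1 / \<beta>) *\<^sub>R y + z)" "b = (2 * (1 - \<beta>)) *\<^sub>R b' + ((1 - \<beta>) / \<beta>) *\<^sub>R y"
    using assms unfolding strengthened_def by blast
  have "0 \<le> inner (((1 / \<beta>) *\<^sub>R x + z) - ((1 / \<beta>) *\<^sub>R y + z)) (a' - b')"
    using M a' b' unfolding monotone_operator_def by blast
  also have "\<dots> = inner (x - y) (a' - b') / \<beta>"
    by (simp add: scaleR_diff_right[symmetric])
  finally have "0 \<le> inner (x - y) (a' - b')"
    using \<beta> by (simp add: zero_le_divide_iff)
  moreover have "a - b = (2 * (1 - \<beta>)) *\<^sub>R (a' - b') + ((1 - \<beta>) / \<beta>) *\<^sub>R (x - y)"
    unfolding a' b' by (simp add: scaleR_diff_right)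
  ultimately show ?thesis
    using \<beta> by (simp add: inner_add_right power2_norm_eq_inner)
qed

text \<open>The odd-looking parameters of the iteration are those that make \<open>x\<close> equal to
  \<open>(I + r T\<^sub>M)\<^sup>-\<^sup>1 v\<close>: multiply the inclusion defining the resolvent of \<open>M\<close> by
  \<open>\<beta> + r (1 - \<beta>)\<close> and collect the multiples of \<open>x\<close>.\<close>

lemma resolvent_step_mem:
  fixes M :: "'a::{real_inner, complete_space} \<Rightarrow> 'a set"
  assumes M: "maximal_monotone M" and \<beta>: "0 < \<beta>" "\<beta> < 1" and r: "0 < r"
    and x: "x = \<beta> *\<^sub>R resolvent (op_scale (2 * r * (1 - \<beta>) / (\<beta> + r * (1 - \<beta>))) M)
           ((1 / (\<beta> + r * (1 - \<beta>))) *\<^sub>R v + z) - \<beta> *\<^sub>R z"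
  shows "(1 / r) *\<^sub>R (v - x) \<in> strengthened \<beta> z M x"
proof -
  define c where "c = \<beta> + r * (1 - \<beta>)"
  define \<rho> where "\<rho> = 2 * r * (1 - \<beta>) / c"
  define w where "w = resolvent (op_scale \<rho> M) ((1 / c) *\<^sub>R v + z)"
  have c: "0 < c"
    unfolding c_def using \<beta> r by (intro add_pos_pos mult_pos_pos) auto
  then have \<rho>: "0 < \<rho>"
    unfolding \<rho>_def using \<beta> r by (intro divide_pos_pos mult_pos_pos) auto
  have w: "w = (1 / \<beta>) *\<^sub>R x + z"
    using \<beta> unfolding x w_def \<rho>_def c_def by (simp add: scaleR_diff_right)
  have "(1 / \<rho>) *\<^sub>R ((1 / c) *\<^sub>R v + z - w) \<in> M w"
    unfolding w_def by (rule resolvent_scale_mem[OF M \<rho>])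
  moreover have "(1 / \<rho>) *\<^sub>R ((1 / c) *\<^sub>R v + z - w)
      = (1 / (2 * r * (1 - \<beta>))) *\<^sub>R (v - (c / \<beta>) *\<^sub>R x)"
    using c by (simp add: w \<rho>_def scaleR_diff_right)
  moreover have "(2 * (1 - \<beta>)) *\<^sub>R ((1 / (2 * r * (1 - \<beta>))) *\<^sub>R (v - (c / \<beta>) *\<^sub>R x))
      + ((1 - \<beta>) / \<beta>) *\<^sub>R x = (1 / r) *\<^sub>R (v - x)"
  proof -
    have "(2 * (1 - \<beta>)) *\<^sub>R ((1 / (2 * r * (1 - \<beta>))) *\<^sub>R (v - (c / \<beta>) *\<^sub>R x))
        = (1 / r) *\<^sub>R (v - (c / \<beta>) *\<^sub>R x)"
    proof -
      have "\<kappa> * (1 / (\<kappa> * r)) = 1 / r" if "0 < \<kappa>" for \<kappa> :: real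
        using that by simp
      from this[of "2 * (1 - \<beta>)"] show ?thesis
        using \<beta> by (simp only: scaleR_scaleR) (simp add: mult_ac)
    qed
    moreover have "(1 / r) *\<^sub>R (c / \<beta>) *\<^sub>R x = (1 / r) *\<^sub>R x + ((1 - \<beta>) / \<beta>) *\<^sub>R x"
    proof -
      have "1 / r * (c / \<beta>) = 1 / r + (1 - \<beta>) / \<beta>"
        using \<beta> r by (simp add: c_def field_simps)
      then show ?thesis
        by (metis scaleR_scaleR scaleR_add_left)
    qed
    ultimately show ?thesis
      by (simp add: scaleR_diff_right)
  qed
  ultimately show ?thesis
    unfolding strengthened_def w by (smt (verit) mem_Collect_eq)
qed

text \<open>The variables stand for differences from a solution: \<open>x, y\<close> for the current pair, \<open>z', b\<close>
  for the intermediate point and the element of \<open>T\<^sub>B\<close> at it, and \<open>x', y'\<close> for the new pair.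
  The estimate rests on the exact identity
  \<open>\<parallel>x\<parallel>\<^sup>2 + r\<^sup>2 \<parallel>y\<parallel>\<^sup>2 = \<parallel>z' + r y\<parallel>\<^sup>2 + \<parallel>r y + r b\<parallel>\<^sup>2 + 2 r \<langle>z', b\<rangle>\<close>, whose last two terms are
  nonnegative, together with \<open>z' + r y = x' + r y'\<close>.\<close>

lemma splitting_step_decrease:
  fixes x y :: "'a::real_inner"
  assumes r: "0 \<le> r" and \<gamma>: "0 \<le> \<gamma>"
    and eq1: "z' + r *\<^sub>R b = x - r *\<^sub>R y" and eq2: "x' + r *\<^sub>R y' = z' + r *\<^sub>R y"
    and B: "\<gamma> * (norm z')\<^sup>2 \<le> inner z' b" and A: "\<gamma> * (norm x')\<^sup>2 \<le> inner x' y'"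
  shows "(1 + 2 * r * \<gamma>) * (norm x')\<^sup>2 + r\<^sup>2 * (norm y')\<^sup>2 \<le> (norm x)\<^sup>2 + r\<^sup>2 * (norm y)\<^sup>2"
proof -
  have x: "x = z' + r *\<^sub>R b + r *\<^sub>R y"
    using eq1 by simp
  have "0 \<le> inner z' b"
    by (rule order_trans[OF _ B]) (use \<gamma> in simp)
  have "(1 + 2 * r * \<gamma>) * (norm x')\<^sup>2 + r\<^sup>2 * (norm y')\<^sup>2
      \<le> (norm x')\<^sup>2 + 2 * r * inner x' y' + r\<^sup>2 * (norm y')\<^sup>2"
    using mult_left_mono[OF A, of "2 * r"] r by (simp add: algebra_simps)
  also have "\<dots> = (norm (x' + r *\<^sub>R y'))\<^sup>2"
    by (simp add: power2_norm_eq_inner inner_add_left inner_add_right inner_commute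
        algebra_simps) (simp add: power2_eq_square)
  also have "\<dots> = (norm (z' + r *\<^sub>R y))\<^sup>2"
    by (simp only: eq2)
  also have "\<dots> \<le> (norm (z' + r *\<^sub>R y))\<^sup>2 + (norm (r *\<^sub>R y + r *\<^sub>R b))\<^sup>2 + 2 * r * inner z' b"
    using r \<open>0 \<le> inner z' b\<close> by simp
  also have "\<dots> = (norm x)\<^sup>2 + r\<^sup>2 * (norm y)\<^sup>2"
    unfolding x by (simp add: power2_norm_eq_inner inner_add_left inner_add_right inner_commute
        algebra_simps) (simp add: power2_eq_square)
  finally show ?thesis .
qed

text \<open>The reciprocals satisfy \<open>(1 / r (k + 1))\<^sup>2 = (1 / r k)\<^sup>2 + 2 \<gamma> / r k\<close>, so they grow
  by at least a fixed amount in each step.\<close>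

lemma step_size_bound:
  fixes r :: "nat \<Rightarrow> real"
  assumes pos: "\<And>k. 0 < r k" and \<gamma>: "0 < \<gamma>"
    and rec: "\<And>k. (1 + 2 * r k * \<gamma>) * (r (k + 1))\<^sup>2 = (r k)\<^sup>2"
  obtains d where "0 < d" "\<And>k. real k * d \<le> 1 / r k"
proof -
  \<comment> \<open>The bounds \<open>d \<le> \<gamma> / 2\<close> and \<open>d \<le> 1 / r 0\<close> give \<open>(s + d)\<^sup>2 \<le> s\<^sup>2 + 2 \<gamma> s\<close> for all
    \<open>s \<ge> 1 / r 0\<close>.\<close>
  define d where "d = min (\<gamma> / 2) (1 / r 0)"
  have d: "0 < d" "d \<le> \<gamma> / 2" "d \<le> 1 / r 0"
    using pos[of 0] \<gamma> by (auto simp: d_def)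
  have *: "1 / r 0 + real k * d \<le> 1 / r k" for k
  proof (induction k)
    case (Suc k)
    define s where "s = 1 / r k"
    have s0: "0 < s" using pos by (simp add: s_def)
    have "d \<le> s"
      using Suc.IH d by (simp add: s_def) (smt (verit) mult_nonneg_nonneg of_nat_0_le_iff)
    have "(s + d)\<^sup>2 = s\<^sup>2 + 2 * (s * d) + d * d"
      by (simp add: power2_eq_square algebra_simps)
    also have "\<dots> \<le> s\<^sup>2 + 2 * (s * (\<gamma> / 2)) + (\<gamma> / 2) * s"
      using d \<open>d \<le> s\<close> s0 by (intro add_mono mult_left_mono mult_mono) auto
    also have "\<dots> \<le> s\<^sup>2 + 2 * \<gamma> * s"
      using \<gamma> s0 by simp
    also have "\<dots> = (1 / r (k + 1))\<^sup>2"
      using rec[of k] pos[of k] pos[of "k + 1"]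
      by (simp add: s_def field_simps power2_eq_square)
    finally have "s + d \<le> 1 / r (k + 1)"
      by (rule power2_le_imp_le) (use pos[of "k + 1"] in simp)
    then show ?case
      using Suc.IH by (simp add: s_def algebra_simps)
  qed simp
  have "real k * d \<le> 1 / r k" for k
    using *[of k] pos[of 0] by (smt (verit) divide_pos_pos)
  with d(1) show ?thesis
    by (rule that)
qed

theorem theorem4p1:
  fixes A B :: "'a::{real_inner, complete_space} \<Rightarrow> 'a set"
    and z :: 'a and \<beta> :: real and r :: "nat \<Rightarrow> real"
    and xs ys zs :: "nat \<Rightarrow> 'a"
  assumes "maximal_monotone A" and "maximal_monotone B"
    and "0 < \<beta>" and "\<beta> < 1"
    and "\<And>k. 0 < r k"
    and "r 0 < 2 * (1 - \<beta>) / \<beta>"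
    and "\<And>k. r (k + 1) = r k / sqrt (1 + 2 * r k * (1 - \<beta>) / \<beta>)"
    and "xs 0 = \<beta> *\<^sub>R resolvent (op_scale (2 * r 0 * (1 - \<beta>) / (\<beta> + r 0 * (1 - \<beta>))) A)
           ((1 / (\<beta> + r 0 * (1 - \<beta>))) *\<^sub>R zs 0 + z) - \<beta> *\<^sub>R z"
    and "ys 0 = (1 / r 0) *\<^sub>R (zs 0 - xs 0)"
    and "\<And>k. 1 \<le> k \<Longrightarrow>
         xs k = \<beta> *\<^sub>R resolvent
           (op_scale (2 * r (k - 1) * (1 - \<beta>) / (\<beta> + r (k - 1) * (1 - \<beta>))) A)
           ((1 / (\<beta> + r (k - 1) * (1 - \<beta>))) *\<^sub>R (zs (k - 1) + r (k - 1) *\<^sub>R ys (k - 1)) + z)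
           - \<beta> *\<^sub>R z"
    and "\<And>k. 1 \<le> k \<Longrightarrow>
         ys k = (1 / r (k - 1)) *\<^sub>R (zs (k - 1) + r (k - 1) *\<^sub>R ys (k - 1) - xs k)"
    and "\<And>k. 1 \<le> k \<Longrightarrow>
         zs k = \<beta> *\<^sub>R resolvent (op_scale (2 * r k * (1 - \<beta>) / (\<beta> + r k * (1 - \<beta>))) B)
           ((1 / (\<beta> + r k * (1 - \<beta>))) *\<^sub>R (xs k - r k *\<^sub>R ys k) + z) - \<beta> *\<^sub>R z"
    and "{u. z \<in> op_add op_id (op_add A B) u} \<noteq> {}"
  shows "(\<lambda>k. (1 / \<beta>) *\<^sub>R xs k + z) \<longlonglongrightarrow> resolvent (op_add A B) z
    \<and> (\<lambda>k. norm ((1 / \<beta>) *\<^sub>R xs (k + 1) + z - resolvent (op_add A B) z))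
        \<in> O(\<lambda>k. 1 / real k)"
proof -
  define \<gamma> where "\<gamma> = (1 - \<beta>) / \<beta>"
  define TA where "TA = strengthened \<beta> z A"
  define TB where "TB = strengthened \<beta> z B"
  note \<beta> = assms(3,4) and pos = assms(5)
  have \<gamma>: "0 < \<gamma>"
    using \<beta> by (simp add: \<gamma>_def)
  have mono: "monotone_operator A" "monotone_operator B"
    using assms(1,2) by (auto simp: maximal_monotone_def)

  have rec: "(1 + 2 * r k * \<gamma>) * (r (k + 1))\<^sup>2 = (r k)\<^sup>2" for k
  proof -
    have "0 < 1 + 2 * r k * \<gamma>"
      using pos[of k] \<gamma> by (simp add: add_pos_pos)
    moreover have "r (k + 1) = r k / sqrt (1 + 2 * r k * \<gamma>)"
      using assms(7)[of k] by (simp add: \<gamma>_def)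
    ultimately show ?thesis
      by (simp add: power_divide)
  qed
  obtain d where d: "0 < d" "\<And>k. real k * d \<le> 1 / r k"
    using step_size_bound[of r \<gamma>] pos \<gamma> rec by metis

  obtain u where u: "z \<in> op_add op_id (op_add A B) u"
    using assms(13) by blast
  then have u_eq: "resolvent (op_add A B) z = u"
    by (intro resolvent_eqI monotone_operator_add mono)
  from u obtain a b where ab: "a \<in> A u" "b \<in> B u" "z = u + (a + b)"
    unfolding op_add_def op_id_def by blast
  define x where "x = \<beta> *\<^sub>R (u - z)"
  have xu: "(1 / \<beta>) *\<^sub>R x + z = u"
    using \<beta> by (simp add: x_def)
  define y where "y = (2 * (1 - \<beta>)) *\<^sub>R a + \<gamma> *\<^sub>R x"
  have yA: "y \<in> TA x"
    unfolding TA_def strengthened_def y_def \<gamma>_def xu using ab by blast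
  have yB: "- y \<in> TB x"
  proof -
    have "\<gamma> *\<^sub>R x = (1 - \<beta>) *\<^sub>R (u - z)"
      using \<beta> by (simp add: \<gamma>_def x_def)
    then have *: "\<gamma> *\<^sub>R x = - ((1 - \<beta>) *\<^sub>R (a + b))"
      unfolding ab(3) by (simp add: algebra_simps)
    have "(2 * (1 - \<beta>)) *\<^sub>R c = (1 - \<beta>) *\<^sub>R c + (1 - \<beta>) *\<^sub>R c" for c :: 'a
      by (simp only: mult_2 scaleR_add_left)
    then have "- y = (2 * (1 - \<beta>)) *\<^sub>R b + \<gamma> *\<^sub>R x"
      unfolding y_def * by (simp add: scaleR_add_right)
    then show ?thesis
      unfolding TB_def strengthened_def \<gamma>_def xu using ab by blast
  qed

  have ysA: "ys (k + 1) \<in> TA (xs (k + 1))" for k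
    using resolvent_step_mem[OF assms(1) \<beta> pos assms(10)[of "k + 1", simplified]]
      assms(11)[of "k + 1"] by (simp add: TA_def)
  define bs where "bs k = (1 / r k) *\<^sub>R (xs k - r k *\<^sub>R ys k - zs k)" for k
  have bsB: "bs k \<in> TB (zs k)" if "1 \<le> k" for k
    unfolding bs_def TB_def by (rule resolvent_step_mem[OF assms(2) \<beta> pos assms(12)[OF that]])

  \<comment> \<open>The decrease starts at index 1: \<open>zs 0\<close> is arbitrary, so \<open>bs 0\<close> need not lie in
    \<open>TB (zs 0)\<close>.\<close>
  define V where "V k = (norm (xs k - x))\<^sup>2 / (r k)\<^sup>2 + (norm (ys k - y))\<^sup>2" for k
  have V_dec: "V (k + 1) \<le> V k" if k: "1 \<le> k" for k
  proof -
    have "(1 + 2 * r k * \<gamma>) * (norm (xs (k + 1) - x))\<^sup>2 + (r k)\<^sup>2 * (norm (ys (k + 1) - y))\<^sup>2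
        \<le> (norm (xs k - x))\<^sup>2 + (r k)\<^sup>2 * (norm (ys k - y))\<^sup>2"
    proof (rule splitting_step_decrease[where z' = "zs k - x" and b = "bs k - (- y)"])
      show "zs k - x + r k *\<^sub>R (bs k - (- y)) = xs k - x - r k *\<^sub>R (ys k - y)"
        using pos[of k] by (simp add: bs_def algebra_simps)
      show "xs (k + 1) - x + r k *\<^sub>R (ys (k + 1) - y) = zs k - x + r k *\<^sub>R (ys k - y)"
      proof -
        have "r k *\<^sub>R ys (k + 1) = zs k + r k *\<^sub>R ys k - xs (k + 1)"
          using pos[of k] assms(11)[of "k + 1"] by simp
        then show ?thesis
          by (simp add: scaleR_diff_right)
      qed
      show "\<gamma> * (norm (zs k - x))\<^sup>2 \<le> inner (zs k - x) (bs k - (- y))"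
        unfolding \<gamma>_def using bsB[OF k] yB unfolding TB_def
        by (rule strengthened_strongly_monotone[OF mono(2) \<beta>])
      show "\<gamma> * (norm (xs (k + 1) - x))\<^sup>2 \<le> inner (xs (k + 1) - x) (ys (k + 1) - y)"
        unfolding \<gamma>_def using ysA[of k] yA unfolding TA_def
        by (rule strengthened_strongly_monotone[OF mono(1) \<beta>])
    qed (use pos[of k] \<gamma> in auto)
    moreover have "(norm (xs k - x))\<^sup>2 + (r k)\<^sup>2 * (norm (ys k - y))\<^sup>2 = (r k)\<^sup>2 * V k"
      using pos[of k] by (simp add: V_def distrib_left)
    moreover have "(1 + 2 * r k * \<gamma>) * (norm (xs (k + 1) - x))\<^sup>2
        + (r k)\<^sup>2 * (norm (ys (k + 1) - y))\<^sup>2 = (r k)\<^sup>2 * V (k + 1)"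
      using pos[of "k + 1"] by (simp add: V_def distrib_left rec[of k, symmetric])
    ultimately have "(r k)\<^sup>2 * V (k + 1) \<le> (r k)\<^sup>2 * V k"
      by simp
    then show ?thesis
      using pos[of k] by simp
  qed
  have V_le: "V (k + 1) \<le> V 1" for k
  proof (induction k)
    case (Suc k)
    then show ?case
      using V_dec[of "k + 1"] by simp
  qed simp

  define C where "C = sqrt (V 1) / (\<beta> * d)"
  have err: "norm ((1 / \<beta>) *\<^sub>R xs (k + 1) + z - resolvent (op_add A B) z) \<le> C * (1 / real (k + 1))" for k
  proof -
    have "(norm (xs (k + 1) - x))\<^sup>2 / (r (k + 1))\<^sup>2 \<le> V (k + 1)"
      by (simp add: V_def)
    also note V_le
    finally have "(norm (xs (k + 1) - x) / r (k + 1))\<^sup>2 \<le> V 1"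
      by (simp add: power_divide)
    then have "norm (xs (k + 1) - x) / r (k + 1) \<le> sqrt (V 1)"
      by (rule real_le_rsqrt)
    then have "norm (xs (k + 1) - x) \<le> sqrt (V 1) * r (k + 1)"
      using pos[of "k + 1"] by (simp add: field_simps)
    also have "\<dots> \<le> sqrt (V 1) * (1 / (real (k + 1) * d))"
    proof (rule mult_left_mono)
      show "r (k + 1) \<le> 1 / (real (k + 1) * d)"
      proof -
        have "0 < real (k + 1) * d"
          using d(1) by (intro mult_pos_pos) auto
        then have "1 / (1 / r (k + 1)) \<le> 1 / (real (k + 1) * d)"
          using d(2)[of "k + 1"] pos[of "k + 1"] by (intro divide_left_mono) auto
        then show ?thesis by simp
      qed
      show "0 \<le> sqrt (V 1)"
        by (simp add: V_def)
    qed
    finally have "norm (xs (k + 1) - x) / \<beta> \<le> sqrt (V 1) * (1 / (real (k + 1) * d)) / \<beta>"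
      using \<beta> by (intro divide_right_mono) auto
    moreover have "(1 / \<beta>) *\<^sub>R xs (k + 1) + z - u = (1 / \<beta>) *\<^sub>R (xs (k + 1) - x)"
      using xu by (simp add: scaleR_diff_right algebra_simps)
    ultimately show ?thesis
      using \<beta> by (simp add: C_def u_eq mult_ac)
  qed

  have "(\<lambda>k. (1 / \<beta>) *\<^sub>R xs k + z) \<longlonglongrightarrow> resolvent (op_add A B) z"
  proof (rule LIMSEQ_offset[where k = 1])
    have "(\<lambda>k. (1 / \<beta>) *\<^sub>R xs (k + 1) + z - resolvent (op_add A B) z) \<longlonglongrightarrow> 0"
    proof (rule Lim_null_comparison)
      show "\<forall>\<^sub>F k in sequentially. norm ((1 / \<beta>) *\<^sub>R xs (k + 1) + z - resolvent (op_add A B) z)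
          \<le> C * (1 / real (k + 1))"
        by (rule always_eventually, rule allI, rule err)
      have "(\<lambda>k. 1 / real (k + 1)) \<longlonglongrightarrow> 0"
        using LIMSEQ_inverse_real_of_nat by (simp add: inverse_eq_divide)
      then show "(\<lambda>k. C * (1 / real (k + 1))) \<longlonglongrightarrow> 0"
        by (rule tendsto_mult_right_zero)
    qed
    then show "(\<lambda>k. (1 / \<beta>) *\<^sub>R xs (k + 1) + z) \<longlonglongrightarrow> resolvent (op_add A B) z"
      by (rule LIM_zero_cancel)
  qed
  moreover have "(\<lambda>k. norm ((1 / \<beta>) *\<^sub>R xs (k + 1) + z - resolvent (op_add A B) z))
        \<in> O(\<lambda>k. 1 / real k)"
  proof (rule bigoI)
    have "0 \<le> C"
      using \<beta> d by (simp add: C_def V_def)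
    then have "C * (1 / real (k + 1)) \<le> C * (1 / real k)" if "1 \<le> k" for k
      using that by (intro mult_left_mono divide_left_mono) auto
    then show "\<forall>\<^sub>F k in sequentially.
        norm (norm ((1 / \<beta>) *\<^sub>R xs (k + 1) + z - resolvent (op_add A B) z)) \<le> C * norm (1 / real k)"
      using err by (intro eventually_sequentiallyI[of 1]) (fastforce intro: order_trans)
  qed
  ultimately show ?thesis ..
qed

end
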